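(* Let $\Omega\subset\mathbb{C}$ be a bounded domain and let $X\subset\mathcal{H}(\Omega)$ be a Banach space of analytic functions that satisfies Axioms (A1), (A2), (A3), (A4) listed in the context. Let $F\in\mathcal{H}(\Omega)$, let $\phi:\Omega\to\Omega$ be analytic, and suppose that the weighted composition operator $W_{F,\phi}f=F\,(f\circ\phi)$ is a bounded operator from $X$ into $X$. (a) $W_{F,\phi}$ is invertible on $X$ if and only if it maps $X$ onto $X$. If this is the case, then $\phi$ is an automorphism of $\Omega$, $F$ does not vanish in $\Omega$, and the inverse operator $W_{F,\phi}^{-1}$ is another weighted composition operator $W_{G,\psi}$, whose symbols are $$G=\frac{1}{F\circ\phi^{-1}},\qquad \psi=\phi^{-1}.$$ (b) Suppose that, in addition, $X$ satisfies Axiom (A5) of the context (so that all of (A1)--(A5) hold). Then $W_{F,\phi}$ is invertible on $X$ if and only if $\phi$ is an automorphism of $\Omega$, $F$ does not vanish in $\Omega$, and $1/F\in\mathcal{M}(X)$. If this is the case, then also $F\in\mathcal{M}(X)$, and the inverse operator is $W_{G,\psi}$ with $G=\dfrac{1}{F\circ\phi^{-1}}$ and $\psi=\phi^{-1}$.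
   Context: A domain is a non-empty connected open set. $\mathcal{H}(\Omega)$ is the algebra of all complex-valued analytic functions in $\Omega$, and $H^\infty(\Omega)$ is the set of bounded functions in $\mathcal{H}(\Omega)$. $X$ is a complex linear subspace of $\mathcal{H}(\Omega)$ equipped with a norm that makes it a Banach space. An automorphism of $\Omega$ is a bijective analytic map of $\Omega$ onto itself. "Invertible on $X$" means having a bounded two-sided inverse on $X$. For $F\in\mathcal{H}(\Omega)$ and an analytic map $\phi:\Omega\to\Omega$, the weighted composition operator with symbols $F$ and $\phi$ is defined by $W_{F,\phi}f=F\,(f\circ\phi)$. A function $u$ in $\Omega$ is a (self-)multiplier of $X$, written $u\in\mathcal{M}(X)$, if $uf\in X$ for all $f\in X$. Axioms: (A1) For every $z\in\Omega$ the point evaluation functional $\Lambda_z:f\mapsto f(z)$ is bounded on $X$. (A2) $\mathbf{1}\in X$, where $\mathbf{1}(z)\equiv 1$. (A3) Whenever $f\in X$, the function $\chi f$ is also in $X$, where $\chi(z)\equiv z$. (A4) For every $u\in H^\infty(\Omega)$ that does not vanish in $\Omega$ and every $f\in X$: if $fu^n\in X$ for all $n\in\mathbb{N}=\{1,2,3,\ldots\}$, then $fu^\alpha\in X$ for some positive non-integer value $\alpha$. Here $u^\alpha$ denotes an analytic branch of the power in $\Omega$, i.e. a function in $\mathcal{H}(\Omega)$ that is locally of the form $\exp(\alpha\log u)$ for some local analytic branch of $\log u$; the axiom asserts that such an $\alpha$ and such a branch exist with $fu^\alpha\in X$. (A5) Each automorphism of $\Omega$ induces a bounded composition operator on $X$: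 for every automorphism $\eta$ of $\Omega$, $f\mapsto f\circ\eta$ is a bounded operator from $X$ into $X$. *)

theory Defs
  imports "HOL-Complex_Analysis.Complex_Analysis"
begin

text \<open>
  Convention: a function on \<open>\<Omega>\<close> that is an element of a function space is represented by its
  extension by \<open>0\<close> to the whole plane, so that equality on \<open>\<Omega>\<close> is plain equality. Symbols of
  operators, multipliers and self-maps of \<open>\<Omega>\<close> are arbitrary functions on the plane of which
  only the values on \<open>\<Omega>\<close> are ever used.
\<close>

definition is_domain :: "complex set \<Rightarrow> bool" where
  "is_domain \<Omega> \<longleftrightarrow> \<Omega> \<noteq> {} \<and> open \<Omega> \<and> connected \<Omega>"

definition analytic_functions :: "complex set \<Rightarrow> (complex \<Rightarrow> complex) set" where
  "analytic_functions \<Omega> = {f. f holomorphic_on \<Omega> \<and> (\<forall>z. z \<notin> \<Omega> \<longrightarrow> f z = 0)}"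

locale analytic_banach_space =
  fixes \<Omega> :: "complex set"
    and X :: "(complex \<Rightarrow> complex) set"
    and N :: "(complex \<Rightarrow> complex) \<Rightarrow> real"
  assumes domain: "is_domain \<Omega>"
    and analytic: "X \<subseteq> analytic_functions \<Omega>"
    and zero_mem: "(\<lambda>z. 0) \<in> X"
    and add_mem: "\<And>f g. f \<in> X \<Longrightarrow> g \<in> X \<Longrightarrow> (\<lambda>z. f z + g z) \<in> X"
    and scale_mem: "\<And>c f. f \<in> X \<Longrightarrow> (\<lambda>z. c * f z) \<in> X"
    and norm_nonneg: "\<And>f. f \<in> X \<Longrightarrow> 0 \<le> N f"
    and norm_eq_zero: "\<And>f. f \<in> X \<Longrightarrow> N f = 0 \<longleftrightarrow> f = (\<lambda>z. 0)"
    and norm_scale: "\<And>c f. f \<in> X \<Longrightarrow> N (\<lambda>z. c * f z) = cmod c * N f"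
    and norm_triangle: "\<And>f g. f \<in> X \<Longrightarrow> g \<in> X \<Longrightarrow> N (\<lambda>z. f z + g z) \<le> N f + N g"
    and complete: "\<And>s :: nat \<Rightarrow> complex \<Rightarrow> complex.
      (\<And>n. s n \<in> X) \<Longrightarrow>
      (\<And>e. e > 0 \<Longrightarrow> \<exists>M. \<forall>m\<ge>M. \<forall>n\<ge>M. N (\<lambda>z. s m z - s n z) < e) \<Longrightarrow>
      \<exists>f\<in>X. (\<lambda>n. N (\<lambda>z. s n z - f z)) \<longlonglongrightarrow> 0"

definition automorphism :: "complex set \<Rightarrow> (complex \<Rightarrow> complex) \<Rightarrow> bool" where
  "automorphism \<Omega> \<phi> \<longleftrightarrow> \<phi> holomorphic_on \<Omega> \<and> bij_betw \<phi> \<Omega> \<Omega>"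

definition bounded_operator ::
  "(complex \<Rightarrow> complex) set \<Rightarrow> ((complex \<Rightarrow> complex) \<Rightarrow> real) \<Rightarrow>
   ((complex \<Rightarrow> complex) \<Rightarrow> (complex \<Rightarrow> complex)) \<Rightarrow> bool" where
  "bounded_operator X N T \<longleftrightarrow>
     (\<forall>f\<in>X. T f \<in> X) \<and>
     (\<forall>f\<in>X. \<forall>g\<in>X. T (\<lambda>z. f z + g z) = (\<lambda>z. T f z + T g z)) \<and>
     (\<forall>c. \<forall>f\<in>X. T (\<lambda>z. c * f z) = (\<lambda>z. c * T f z)) \<and>
     (\<exists>C. \<forall>f\<in>X. N (T f) \<le> C * N f)"

definition bounded_inverse ::
  "(complex \<Rightarrow> complex) set \<Rightarrow> ((complex \<Rightarrow> complex) \<Rightarrow> real) \<Rightarrow>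
   ((complex \<Rightarrow> complex) \<Rightarrow> (complex \<Rightarrow> complex)) \<Rightarrow>
   ((complex \<Rightarrow> complex) \<Rightarrow> (complex \<Rightarrow> complex)) \<Rightarrow> bool" where
  "bounded_inverse X N T S \<longleftrightarrow>
     bounded_operator X N S \<and> (\<forall>f\<in>X. S (T f) = f) \<and> (\<forall>f\<in>X. T (S f) = f)"

definition invertible_on ::
  "(complex \<Rightarrow> complex) set \<Rightarrow> ((complex \<Rightarrow> complex) \<Rightarrow> real) \<Rightarrow>
   ((complex \<Rightarrow> complex) \<Rightarrow> (complex \<Rightarrow> complex)) \<Rightarrow> bool" where
  "invertible_on X N T \<longleftrightarrow> (\<exists>S. bounded_inverse X N T S)"

definition weighted_comp ::
  "complex set \<Rightarrow> (complex \<Rightarrow> complex) \<Rightarrow> (complex \<Rightarrow> complex) \<Rightarrow>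
   (complex \<Rightarrow> complex) \<Rightarrow> (complex \<Rightarrow> complex)" where
  "weighted_comp \<Omega> F \<phi> f = (\<lambda>z. if z \<in> \<Omega> then F z * f (\<phi> z) else 0)"

definition comp_operator ::
  "complex set \<Rightarrow> (complex \<Rightarrow> complex) \<Rightarrow> (complex \<Rightarrow> complex) \<Rightarrow> (complex \<Rightarrow> complex)" where
  "comp_operator \<Omega> \<eta> f = (\<lambda>z. if z \<in> \<Omega> then f (\<eta> z) else 0)"

text \<open>No restriction to \<open>\<Omega>\<close> is needed here: \<open>u f\<close> vanishes wherever \<open>f\<close> does.\<close>

definition multipliers :: "(complex \<Rightarrow> complex) set \<Rightarrow> (complex \<Rightarrow> complex) set" where
  "multipliers X = {u. \<forall>f\<in>X. (\<lambda>z. u z * f z) \<in> X}"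

definition power_branch ::
  "complex set \<Rightarrow> (complex \<Rightarrow> complex) \<Rightarrow> real \<Rightarrow> (complex \<Rightarrow> complex) \<Rightarrow> bool" where
  "power_branch \<Omega> u \<alpha> v \<longleftrightarrow>
     v holomorphic_on \<Omega> \<and>
     (\<forall>z\<in>\<Omega>. \<exists>U l. open U \<and> z \<in> U \<and> U \<subseteq> \<Omega> \<and> l holomorphic_on U \<and>
        (\<forall>w\<in>U. exp (l w) = u w \<and> v w = exp (of_real \<alpha> * l w)))"

definition axiom_A1 ::
  "complex set \<Rightarrow> (complex \<Rightarrow> complex) set \<Rightarrow> ((complex \<Rightarrow> complex) \<Rightarrow> real) \<Rightarrow> bool" where
  "axiom_A1 \<Omega> X N \<longleftrightarrow> (\<forall>z\<in>\<Omega>. \<exists>C. \<forall>f\<in>X. cmod (f z) \<le> C * N f)"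

definition axiom_A2 :: "complex set \<Rightarrow> (complex \<Rightarrow> complex) set \<Rightarrow> bool" where
  "axiom_A2 \<Omega> X \<longleftrightarrow> (\<lambda>z. if z \<in> \<Omega> then 1 else 0) \<in> X"

definition axiom_A3 :: "(complex \<Rightarrow> complex) set \<Rightarrow> bool" where
  "axiom_A3 X \<longleftrightarrow> (\<forall>f\<in>X. (\<lambda>z. z * f z) \<in> X)"

definition axiom_A4 :: "complex set \<Rightarrow> (complex \<Rightarrow> complex) set \<Rightarrow> bool" where
  "axiom_A4 \<Omega> X \<longleftrightarrow>
     (\<forall>u. u holomorphic_on \<Omega> \<and> bounded (u ` \<Omega>) \<and> (\<forall>z\<in>\<Omega>. u z \<noteq> 0) \<longrightarrow>
       (\<forall>f\<in>X. (\<forall>n::nat. n \<ge> 1 \<longrightarrow> (\<lambda>z. f z * u z ^ n) \<in> X) \<longrightarrow>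
         (\<exists>\<alpha>::real. \<alpha> > 0 \<and> \<alpha> \<notin> \<int> \<and>
           (\<exists>v. power_branch \<Omega> u \<alpha> v \<and> (\<lambda>z. f z * v z) \<in> X))))"

definition axiom_A5 ::
  "complex set \<Rightarrow> (complex \<Rightarrow> complex) set \<Rightarrow> ((complex \<Rightarrow> complex) \<Rightarrow> real) \<Rightarrow> bool" where
  "axiom_A5 \<Omega> X N \<longleftrightarrow>
     (\<forall>\<eta>. automorphism \<Omega> \<eta> \<longrightarrow> bounded_operator X N (comp_operator \<Omega> \<eta>))"

end

theory Submission
  imports Defs
begin

text \<open>
  The heart of the matter is that an operator \<open>W f = F (f \<circ> \<phi>)\<close> mapping \<open>X\<close> onto itself forces \<open>\<phi>\<close>
  to be an automorphism and \<open>F\<close> to be zero-free (lemmas \<open>onto_imp_nonzero_inj\<close> and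
  \<open>onto_imp_automorphism\<close>).

  Solving \<open>W f = 1\<close> and \<open>W g = \<chi>\<close> gives \<open>F (f \<circ> \<phi>) = 1\<close> and \<open>F (g \<circ> \<phi>) = \<chi>\<close> on \<open>\<Omega>\<close>. The first
  equation shows that \<open>F\<close> has no zeros. Together they express \<open>z\<close> as \<open>g (\<phi> z) / f (\<phi> z)\<close>, so that
  \<open>\<phi>\<close> is injective.

  Suppose that \<open>\<phi>\<close> omits a point \<open>w\<close> of \<open>\<Omega>\<close>. Then \<open>u = \<phi> - w\<close> is bounded and zero-free, and
  \<open>F u ^ n = W ((\<chi> - w) ^ n)\<close> belongs to \<open>X\<close> for every \<open>n\<close>. The fractional power axiom puts some
  non-integer power \<open>F u ^ \<alpha>\<close> in \<open>X\<close>, and by surjectivity it equals \<open>W g\<close>. Hence \<open>g (\<phi> z)\<close> is a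
  branch of \<open>(\<phi> z - w) ^ \<alpha>\<close>, which means that \<open>g\<close>, holomorphic on all of \<open>\<Omega>\<close>, is a branch of
  \<open>(\<zeta> - w) ^ \<alpha>\<close> on the open set \<open>\<phi> ` \<Omega>\<close>. The point \<open>w\<close> would be a branch point of \<open>g\<close>. To derive
  the contradiction without speaking of monodromy, \<open>power_branch_not_factor_through\<close> uses the
  differential equation \<open>(\<zeta> - w) g' = \<alpha> g\<close>: it continues analytically from \<open>\<phi> ` \<Omega>\<close> to \<open>\<Omega>\<close>, and
  its only holomorphic solution near \<open>w\<close> is zero when \<open>\<alpha>\<close> is not a natural number
  (\<open>euler_ode_eq_0\<close>).

  Once \<open>\<phi>\<close> is an automorphism and \<open>F\<close> is zero-free, the algebraic inverse of \<open>W\<close> is visibly the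
  weighted composition operator with symbols \<open>1 / (F \<circ> \<phi>\<^sup>-\<^sup>1)\<close> and \<open>\<phi>\<^sup>-\<^sup>1\<close>. That it is bounded is
  Banach's theorem, \<open>bounded_inverse_theorem\<close>, proved from the Baire category theorem for the
  metric of \<open>X\<close>.

  When composition with automorphisms preserves \<open>X\<close>, the operator \<open>W\<close> differs from multiplication
  by \<open>F\<close> only by a composition operator that is a bijection of \<open>X\<close>, and surjectivity of \<open>W\<close> turns
  into the condition that \<open>1 / F\<close> is a multiplier.
\<close>

section \<open>The bounded inverse theorem\<close>

context analytic_banach_space
begin

lemma diff_mem: "f \<in> X \<Longrightarrow> g \<in> X \<Longrightarrow> (\<lambda>z. f z - g z) \<in> X"
  using add_mem[of f "\<lambda>z. - 1 * g z"] scale_mem[of g "- 1"] by simp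

lemma norm_zero: "N (\<lambda>z. 0) = 0"
  using norm_eq_zero zero_mem by blast

lemma norm_minus_commute:
  assumes "f \<in> X" "g \<in> X"
  shows "N (\<lambda>z. f z - g z) = N (\<lambda>z. g z - f z)"
  using norm_scale[of "\<lambda>z. f z - g z" "- 1"] diff_mem[OF assms] by simp

lemma norm_diff_triangle:
  assumes "f \<in> X" "g \<in> X" "h \<in> X"
  shows "N (\<lambda>z. f z - h z) \<le> N (\<lambda>z. f z - g z) + N (\<lambda>z. g z - h z)"
  using norm_triangle[OF diff_mem[of f g] diff_mem[of g h]] assms by simp

lemma norm_diff_le:
  assumes "f \<in> X" "g \<in> X"
  shows "N (\<lambda>z. f z - g z) \<le> N f + N g"
  using norm_triangle[of f "\<lambda>z. - 1 * g z"] norm_scale[of g "- 1"] scale_mem[of g "- 1"] assms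
  by simp

text \<open>
  The value \<open>0\<close> off \<open>X\<close> is there because a metric in the sense of \<open>Metric_space\<close> must be
  nonnegative and symmetric for all arguments, whereas the norm is controlled on \<open>X\<close> only.
\<close>

definition norm_dist :: "(complex \<Rightarrow> complex) \<Rightarrow> (complex \<Rightarrow> complex) \<Rightarrow> real" where
  "norm_dist f g = (if f \<in> X \<and> g \<in> X then N (\<lambda>z. f z - g z) else 0)"

lemma metric_space_norm_dist: "Metric_space X norm_dist"
proof
  fix f g assume fg: "f \<in> X" "g \<in> X"
  have "norm_dist f g = 0 \<longleftrightarrow> (\<lambda>z. f z - g z) = (\<lambda>z. 0)"
    using fg norm_eq_zero[OF diff_mem[OF fg]] by (simp add: norm_dist_def)
  then show "norm_dist f g = 0 \<longleftrightarrow> f = g"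
    by (auto simp: fun_eq_iff)
next
  fix f g show "norm_dist f g = norm_dist g f"
    using norm_minus_commute[of f g] by (auto simp: norm_dist_def)
qed (auto simp: norm_dist_def norm_nonneg diff_mem norm_diff_triangle)

interpretation X: Metric_space X norm_dist
  by (rule metric_space_norm_dist)

lemma mcomplete_norm_dist: "X.mcomplete"
  unfolding X.mcomplete_def
proof (intro allI impI)
  fix s assume "X.MCauchy s"
  then have s: "\<And>n. s n \<in> X"
    and Cauchy: "\<And>e. e > 0 \<Longrightarrow> \<exists>M. \<forall>m n. M \<le> m \<longrightarrow> M \<le> n \<longrightarrow> norm_dist (s m) (s n) < e"
    by (auto simp: X.MCauchy_def)
  obtain f where "f \<in> X" "(\<lambda>n. N (\<lambda>z. s n z - f z)) \<longlonglongrightarrow> 0"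
    using complete[of s] s Cauchy by (auto simp: norm_dist_def)
  then show "\<exists>x. limitin X.mtopology s x sequentially"
    using s by (intro exI[of _ f])
      (auto simp: X.limitin_metric norm_dist_def elim!: order_tendstoD(2))
qed

text \<open>
  The Baire step. The sets where \<open>N (S f) \<le> n\<close> exhaust \<open>X\<close>, so the closure of one of them
  contains a ball, centred at some \<open>f\<close>. Approximating both \<open>f + g\<close> and \<open>f\<close> from that set and
  subtracting moves the ball to the origin, at the price of doubling the bound. Points of
  the closure are only limits of points where \<open>S\<close> is controlled, so the bound holds for elements \<open>h\<close>
  arbitrarily close to \<open>g\<close>; passing to \<open>g\<close> itself takes completeness once more.
\<close>

lemma linear_map_bounded_on_dense_part_of_ball:
  assumes S: "\<And>f. f \<in> X \<Longrightarrow> S f \<in> X"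
    and diff: "\<And>f g. f \<in> X \<Longrightarrow> g \<in> X \<Longrightarrow> S (\<lambda>z. f z - g z) = (\<lambda>z. S f z - S g z)"
  obtains r B where "r > 0" "B \<ge> 0"
    "\<And>g e. g \<in> X \<Longrightarrow> N g < r \<Longrightarrow> e > 0 \<Longrightarrow> \<exists>h\<in>X. N (S h) \<le> B \<and> N (\<lambda>z. g z - h z) < e"
proof -
  define A where "A n = {f \<in> X. N (S f) \<le> real n}" for n
  have "(\<Union>n. A n) = X"
    unfolding A_def using real_arch_simple by auto
  moreover have "A n \<subseteq> X.mtopology closure_of A n" for n
    by (rule closure_of_subset) (auto simp: A_def)
  moreover have "X.mtopology closure_of A n \<subseteq> X" for n
    using closure_of_subset_topspace[of X.mtopology] by simp
  ultimately have cover: "(\<Union>n. X.mtopology closure_of A n) = X"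
    by blast
  have "\<exists>n. X.mtopology interior_of (X.mtopology closure_of A n) \<noteq> {}"
  proof (rule ccontr)
    assume "\<nexists>n. X.mtopology interior_of (X.mtopology closure_of A n) \<noteq> {}"
    then have "X.mtopology interior_of (\<Union>n. X.mtopology closure_of A n) = {}"
      by (intro X.metric_Baire_category_alt mcomplete_norm_dist) auto
    moreover have "X.mtopology interior_of X = X"
      using interior_of_topspace[of X.mtopology] by simp
    ultimately show False
      using cover zero_mem by simp
  qed
  then obtain n where "X.mtopology interior_of (X.mtopology closure_of A n) \<noteq> {}"
    by blast
  then obtain f r where f: "f \<in> X" and r: "r > 0"
    and ball: "X.mball f r \<subseteq> X.mtopology closure_of A n"
    by (auto simp: X.metric_interior_of)
  have approx: "\<exists>h\<in>X. N (S h) \<le> n \<and> N (\<lambda>z. g z - h z) < e"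
    if "g \<in> X" "N (\<lambda>z. f z - g z) < r" "e > 0" for g e
  proof -
    have "g \<in> X.mball f r"
      using that(1,2) f by (simp add: norm_dist_def)
    with ball have "g \<in> X.mtopology closure_of A n" ..
    then obtain h where "h \<in> A n" "h \<in> X.mball g e"
      using \<open>e > 0\<close> unfolding X.metric_closure_of by blast
    then show ?thesis
      by (auto simp: A_def norm_dist_def)
  qed
  show ?thesis
  proof
    fix g e assume g: "g \<in> X" "N g < r" and e: "e > (0::real)"
    have fg: "(\<lambda>z. f z + g z) \<in> X"
      using f g(1) by (rule add_mem)
    have "N (\<lambda>z. f z - (f z + g z)) < r"
      using norm_minus_commute[OF f fg] g by simp
    then obtain h1 where h1: "h1 \<in> X" "N (S h1) \<le> n" "N (\<lambda>z. f z + g z - h1 z) < e / 2"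
      using approx[OF fg _ half_gt_zero[OF e]] by blast
    have "N (\<lambda>z. f z - f z) < r"
      using r norm_zero by simp
    then obtain h2 where h2: "h2 \<in> X" "N (S h2) \<le> n" "N (\<lambda>z. f z - h2 z) < e / 2"
      using approx[OF f _ half_gt_zero[OF e]] by blast
    define h where "h = (\<lambda>z. h1 z - h2 z)"
    have "N (S h) \<le> 2 * real n"
      using norm_diff_le[OF S S, of h1 h2] h1 h2 diff[of h1 h2] by (simp add: h_def)
    moreover have "N (\<lambda>z. g z - h z) < e"
      using norm_diff_le[OF diff_mem[OF fg h1(1)] diff_mem[OF f h2(1)]] h1 h2
      by (simp add: h_def algebra_simps)
    ultimately show "\<exists>h\<in>X. N (S h) \<le> 2 * real n \<and> N (\<lambda>z. g z - h z) < e"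
      using diff_mem[OF h1(1) h2(1)] by (auto simp: h_def)
  qed (use r in auto)
qed

text \<open>
  By homogeneity the approximations inside a small ball become approximations of arbitrary
  elements with relative error one half, which is what a geometric iteration needs.
\<close>

lemma linear_map_bounded_on_half_approximations:
  assumes S: "\<And>f. f \<in> X \<Longrightarrow> S f \<in> X"
    and diff: "\<And>f g. f \<in> X \<Longrightarrow> g \<in> X \<Longrightarrow> S (\<lambda>z. f z - g z) = (\<lambda>z. S f z - S g z)"
    and scale: "\<And>c f. f \<in> X \<Longrightarrow> S (\<lambda>z. c * f z) = (\<lambda>z. c * S f z)"
  obtains K where "K \<ge> 0"
    "\<And>g. g \<in> X \<Longrightarrow> \<exists>h\<in>X. N (S h) \<le> K * N g \<and> N (\<lambda>z. g z - h z) \<le> N g / 2"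
proof -
  obtain r B where r: "r > 0" and B: "B \<ge> 0" and approx:
    "\<And>g e. g \<in> X \<Longrightarrow> N g < r \<Longrightarrow> e > 0 \<Longrightarrow> \<exists>h\<in>X. N (S h) \<le> B \<and> N (\<lambda>z. g z - h z) < e"
    using linear_map_bounded_on_dense_part_of_ball[of S, OF S diff] by blast
  show ?thesis
  proof
    show "2 * B / r \<ge> 0"
      using r B by simp
    fix g assume g: "g \<in> X"
    show "\<exists>h\<in>X. N (S h) \<le> 2 * B / r * N g \<and> N (\<lambda>z. g z - h z) \<le> N g / 2"
    proof (cases "N g = 0")
      case True
      have "S g = (\<lambda>z. 0)"
        using True g norm_eq_zero[OF g] scale[OF zero_mem, of 0] by simp
      then show ?thesis
        using True g norm_zero by (intro bexI[of _ g]) auto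
    next
      case False
      then have Ng: "N g > 0"
        using norm_nonneg[OF g] by simp
      \<comment> \<open>Scaling by \<open>c\<close> puts \<open>g\<close> on the sphere of radius \<open>r / 2\<close>, and half of that radius is
        the admissible error.\<close>
      define c where "c = r / (2 * N g)"
      have c: "c > 0" "c * N g = r / 2"
        using Ng r by (auto simp: c_def)
      have "N (\<lambda>z. of_real c * g z) < r"
        using norm_scale[OF g, of "of_real c"] c r by simp
      then obtain h where h: "h \<in> X" "N (S h) \<le> B" "N (\<lambda>z. of_real c * g z - h z) < r / 4"
        using approx[OF scale_mem[OF g, of "of_real c"], of "r / 4"] r by auto
      define k where "k = (\<lambda>z. of_real (1 / c) * h z)"
      have "N (S k) = 1 / c * N (S h)"
        using scale[OF h(1), of "of_real (1 / c)"] norm_scale[OF S[OF h(1)], of "of_real (1 / c)"] c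
        by (simp add: k_def norm_divide)
      also have "\<dots> \<le> 1 / c * B"
        using h c by (intro mult_left_mono) auto
      also have "\<dots> = 2 * B / r * N g"
        using Ng r by (simp add: c_def)
      finally have "N (S k) \<le> 2 * B / r * N g" .
      moreover have "(\<lambda>z. g z - k z) = (\<lambda>z. of_real (1 / c) * (of_real c * g z - h z))"
        using c by (auto simp: k_def field_simps)
      then have "N (\<lambda>z. g z - k z) = 1 / c * N (\<lambda>z. of_real c * g z - h z)"
        using norm_scale[OF diff_mem[OF scale_mem[OF g] h(1)], of "of_real (1 / c)" "of_real c"] c
        by (simp add: norm_divide)
      then have "N (\<lambda>z. g z - k z) \<le> 1 / c * (r / 4)"
        using h(3) c by (simp add: field_simps)
      then have "N (\<lambda>z. g z - k z) \<le> N g / 2"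
        using Ng r by (simp add: c_def)
      ultimately show ?thesis
        using scale_mem[OF h(1), of "of_real (1 / c)"] by (auto simp: k_def)
    qed
  qed
qed

text \<open>
  Starting from \<open>g\<close>, repeatedly subtract a half approximation. The remainders \<open>R n\<close> decay like
  \<open>2 ^ (-n)\<close>, and so do the increments of \<open>s n = S (g - R n)\<close>. By completeness \<open>s n\<close> tends to some
  \<open>f\<close> whose norm is at most a constant times that of \<open>g\<close>. Continuity of \<open>T\<close> gives
  \<open>T f = lim (g - R n) = g\<close>, so that \<open>f\<close> is \<open>S g\<close>.
\<close>

lemma bounded_inverse_theorem:
  assumes T: "bounded_operator X N T"
    and S: "\<And>f. f \<in> X \<Longrightarrow> S f \<in> X"
    and ST: "\<And>f. f \<in> X \<Longrightarrow> S (T f) = f"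
    and TS: "\<And>f. f \<in> X \<Longrightarrow> T (S f) = f"
  shows "bounded_inverse X N T S"
proof -
  have T_mem: "T f \<in> X" if "f \<in> X" for f
    using T that by (auto simp: bounded_operator_def)
  have T_add: "T (\<lambda>z. f z + g z) = (\<lambda>z. T f z + T g z)" if "f \<in> X" "g \<in> X" for f g
    using T that by (auto simp: bounded_operator_def)
  have T_scale: "T (\<lambda>z. c * f z) = (\<lambda>z. c * T f z)" if "f \<in> X" for c f
    using T that by (auto simp: bounded_operator_def)
  obtain C0 where C0: "\<And>f. f \<in> X \<Longrightarrow> N (T f) \<le> C0 * N f"
    using T unfolding bounded_operator_def by blast
  have S_add: "S (\<lambda>z. f z + g z) = (\<lambda>z. S f z + S g z)" if "f \<in> X" "g \<in> X" for f g
    using ST[OF add_mem[OF S S], of f g] T_add[OF S S, of f g] TS that by simp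
  have S_scale: "S (\<lambda>z. c * f z) = (\<lambda>z. c * S f z)" if "f \<in> X" for c f
    using ST[OF scale_mem[OF S], of f c] T_scale[OF S, of f c] TS that by simp
  have S_diff: "S (\<lambda>z. f z - g z) = (\<lambda>z. S f z - S g z)" if "f \<in> X" "g \<in> X" for f g
    using S_add[of f "\<lambda>z. - 1 * g z"] S_scale[of g "- 1"] scale_mem[of g "- 1"] that by simp
  have T_diff: "T (\<lambda>z. f z - g z) = (\<lambda>z. T f z - T g z)" if "f \<in> X" "g \<in> X" for f g
    using T_add[of f "\<lambda>z. - 1 * g z"] T_scale[of g "- 1"] scale_mem[of g "- 1"] that by simp
  obtain K where K: "K \<ge> 0" and approx:
    "\<And>g. g \<in> X \<Longrightarrow> \<exists>h\<in>X. N (S h) \<le> K * N g \<and> N (\<lambda>z. g z - h z) \<le> N g / 2"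
    using linear_map_bounded_on_half_approximations[of S, OF S S_diff S_scale] by blast
  then obtain H where H: "\<And>g. g \<in> X \<Longrightarrow> H g \<in> X" "\<And>g. g \<in> X \<Longrightarrow> N (S (H g)) \<le> K * N g"
    "\<And>g. g \<in> X \<Longrightarrow> N (\<lambda>z. g z - H g z) \<le> N g / 2"
    by metis
  have bound: "N (S g) \<le> 2 * K * N g" if g: "g \<in> X" for g
  proof -
    define R where "R = rec_nat g (\<lambda>_ f z. f z - H f z)"
    have R_simps: "R 0 = g" "R (Suc n) = (\<lambda>z. R n z - H (R n) z)" for n
      by (simp_all add: R_def)
    have R: "R n \<in> X" for n
      by (induction n) (auto simp: R_simps g H diff_mem)
    have NR: "N (R n) \<le> N g / 2 ^ n" for n
    proof (induction n)
      case (Suc n)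
      then show ?case
        using H(3)[OF R[of n]] by (simp add: R_simps)
    qed (simp add: R_simps)
    define s where "s n = S (\<lambda>z. g z - R n z)" for n
    have s: "s n \<in> X" for n
      unfolding s_def using S diff_mem g R by blast
    have s_0: "s 0 = (\<lambda>z. 0)"
      using S_diff[OF g g] by (simp add: s_def R_simps)
    have step: "N (\<lambda>z. s (Suc n) z - s n z) \<le> K * N g / 2 ^ n" for n
    proof -
      have "(\<lambda>z. s (Suc n) z - s n z) = S (H (R n))"
        unfolding s_def
        using S_diff[OF diff_mem[OF g R] diff_mem[OF g R], of "Suc n" n] by (simp add: R_simps)
      then have "N (\<lambda>z. s (Suc n) z - s n z) \<le> K * N (R n)"
        using H(2)[OF R] by simp
      also have "\<dots> \<le> K * (N g / 2 ^ n)"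
        using K NR by (intro mult_left_mono) auto
      finally show ?thesis
        by simp
    qed
    \<comment> \<open>The bound telescopes: it is the partial sum of the geometric series of the steps.\<close>
    have tail: "N (\<lambda>z. s (n + k) z - s n z) \<le> 2 * K * N g / 2 ^ n - 2 * K * N g / 2 ^ (n + k)"
      for n k
    proof (induction k)
      case 0
      show ?case
        by (simp add: norm_zero)
    next
      case (Suc k)
      have "N (\<lambda>z. s (n + Suc k) z - s n z)
          \<le> K * N g / 2 ^ (n + k) + (2 * K * N g / 2 ^ n - 2 * K * N g / 2 ^ (n + k))"
        using norm_diff_triangle[OF s s s, of "n + Suc k" n "n + k"] step[of "n + k"] Suc by simp
      also have "\<dots> = 2 * K * N g / 2 ^ n - 2 * K * N g / 2 ^ (n + Suc k)"
        by (simp add: field_simps)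
      finally show ?case .
    qed
    have KNg: "0 \<le> 2 * K * N g / 2 ^ n" for n
      using K norm_nonneg[OF g] by simp
    have tail_le: "N (\<lambda>z. s m z - s n z) \<le> 2 * K * N g / 2 ^ n" if "n \<le> m" for m n
      using tail[of n "m - n"] KNg[of m] that by simp
    have pow0: "(\<lambda>n. a / 2 ^ n) \<longlonglongrightarrow> 0" for a :: real
      by real_asymp
    have "\<exists>f\<in>X. (\<lambda>n. N (\<lambda>z. s n z - f z)) \<longlonglongrightarrow> 0"
    proof (rule complete[OF s])
      fix e :: real assume "e > 0"
      then obtain M where M: "2 * (2 * K * N g) / 2 ^ M < e"
        using order_tendstoD(2)[OF pow0[of "2 * (2 * K * N g)"]]
        by (auto simp: eventually_sequentially)
      have "N (\<lambda>z. s m z - s n z) < e" if "m \<ge> M" "n \<ge> M" for m n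
        using norm_diff_triangle[OF s s s, of m n M] norm_minus_commute[OF s s, of M n]
          tail_le[OF that(1)] tail_le[OF that(2)] M by simp
      then show "\<exists>M. \<forall>m\<ge>M. \<forall>n\<ge>M. N (\<lambda>z. s m z - s n z) < e"
        by blast
    qed
    then obtain f where f: "f \<in> X" and lim: "(\<lambda>n. N (\<lambda>z. s n z - f z)) \<longlonglongrightarrow> 0"
      by blast
    have "N (\<lambda>z. g z - T f z) \<le> N g / 2 ^ n + C0 * N (\<lambda>z. s n z - f z)" for n
    proof -
      have "T (s n) = (\<lambda>z. g z - R n z)"
        unfolding s_def using TS diff_mem[OF g R] by blast
      then have "(\<lambda>z. g z - T f z) = (\<lambda>z. R n z + T (\<lambda>z. s n z - f z) z)"
        by (simp add: T_diff[OF s f])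
      then show ?thesis
        using norm_triangle[OF R T_mem[OF diff_mem[OF s f]], of n n] NR[of n]
          C0[OF diff_mem[OF s f], of n] by simp
    qed
    moreover have "(\<lambda>n. N g / 2 ^ n + C0 * N (\<lambda>z. s n z - f z)) \<longlonglongrightarrow> 0"
      using tendsto_add[OF pow0 tendsto_mult_left[OF lim]] by simp
    ultimately have "N (\<lambda>z. g z - T f z) \<le> 0"
      by (intro tendsto_lowerbound) auto
    then have "(\<lambda>z. g z - T f z) = (\<lambda>z. 0)"
      using norm_eq_zero[OF diff_mem[OF g T_mem[OF f]]] norm_nonneg[OF diff_mem[OF g T_mem[OF f]]]
      by simp
    then have "T f = g"
      by (auto simp: fun_eq_iff)
    then have Sg: "S g = f"
      using ST f by blast
    have "N f \<le> 2 * K * N g + N (\<lambda>z. s n z - f z)" for n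
      using norm_diff_le[OF s diff_mem[OF s f], of n n] tail_le[of 0 n] s_0 by simp
    moreover have "(\<lambda>n. 2 * K * N g + N (\<lambda>z. s n z - f z)) \<longlonglongrightarrow> 2 * K * N g"
      using tendsto_add[OF tendsto_const lim] by simp
    ultimately show "N (S g) \<le> 2 * K * N g"
      unfolding Sg by (intro tendsto_lowerbound) auto
  qed
  show ?thesis
    unfolding bounded_inverse_def bounded_operator_def
    using S S_add S_scale bound ST TS by blast
qed

end

section \<open>Non-integer powers have no analytic continuation to a branch point\<close>

text \<open>
  Differentiating \<open>n\<close> times turns the equation into \<open>(z - w) g\<^bsup>(n+1)\<^esup> = (\<alpha> - n) g\<^bsup>(n)\<^esup>\<close>. At
  \<open>z = w\<close> the factor \<open>\<alpha> - n\<close> is nonzero, so all Taylor coefficients of \<open>g\<close> at \<open>w\<close> vanish.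
\<close>

lemma euler_ode_eq_0:
  assumes "open S" "connected S" "g holomorphic_on S" "w \<in> S"
    and "\<alpha> \<notin> \<nat>"
    and ode: "\<And>z. z \<in> S \<Longrightarrow> (z - w) * deriv g z = \<alpha> * g z"
    and "z \<in> S"
  shows "g z = 0"
proof (rule holomorphic_fun_eq_0_on_connected[OF assms(3,1,2) _ assms(4,7)])
  have ode_n: "\<forall>z\<in>S. (z - w) * (deriv ^^ Suc n) g z = (\<alpha> - of_nat n) * (deriv ^^ n) g z" for n
  proof (induction n)
    case 0
    show ?case
      using ode by simp
  next
    case (Suc n)
    show ?case
    proof
      fix z assume z: "z \<in> S"
      have D: "((deriv ^^ k) g has_field_derivative (deriv ^^ Suc k) g z) (at z)" for k
        using holomorphic_derivI[OF holomorphic_higher_deriv[OF assms(3,1)] assms(1) z] by simp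
      have "((\<lambda>z. (z - w) * (deriv ^^ Suc n) g z) has_field_derivative
          (deriv ^^ Suc n) g z + (z - w) * (deriv ^^ Suc (Suc n)) g z) (at z)"
        using DERIV_mult[OF DERIV_diff[OF DERIV_ident DERIV_const[of w]] D[of "Suc n"]]
        by (simp add: algebra_simps)
      moreover have "((\<lambda>z. (\<alpha> - of_nat n) * (deriv ^^ n) g z) has_field_derivative
          (\<alpha> - of_nat n) * (deriv ^^ Suc n) g z) (at z)"
        by (rule DERIV_cmult[OF D])
      then have "((\<lambda>z. (z - w) * (deriv ^^ Suc n) g z) has_field_derivative
          (\<alpha> - of_nat n) * (deriv ^^ Suc n) g z) (at z)"
        by (rule has_field_derivative_transform_within_open[OF _ assms(1) z]) (use Suc in auto)
      ultimately have "(deriv ^^ Suc n) g z + (z - w) * (deriv ^^ Suc (Suc n)) g z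
          = (\<alpha> - of_nat n) * (deriv ^^ Suc n) g z"
        by (rule DERIV_unique)
      then show "(z - w) * (deriv ^^ Suc (Suc n)) g z
          = (\<alpha> - of_nat (Suc n)) * (deriv ^^ Suc n) g z"
        by (simp add: algebra_simps)
    qed
  qed
  show "(deriv ^^ n) g w = 0" for n
    using ode_n[of n] assms(4,5) by force
qed

lemma power_branch_nonzero:
  assumes "power_branch \<Omega> u \<alpha> v" "z \<in> \<Omega>"
  shows "v z \<noteq> 0"
  using assms unfolding power_branch_def by (metis exp_not_eq_zero)

text \<open>
  The logarithmic derivative of \<open>u ^ \<alpha>\<close> is \<open>\<alpha> u' / u\<close>, whichever local branch is used; cleared of
  its denominator, this is a relation in which the local logarithms no longer occur.
\<close>

lemma power_branch_deriv:
  assumes "power_branch \<Omega> u \<alpha> v" "z \<in> \<Omega>"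
  shows "u z * deriv v z = of_real \<alpha> * deriv u z * v z"
proof -
  obtain U l where U: "open U" "z \<in> U" and l: "l holomorphic_on U"
    and ul: "\<And>w. w \<in> U \<Longrightarrow> exp (l w) = u w"
    and vl: "\<And>w. w \<in> U \<Longrightarrow> exp (of_real \<alpha> * l w) = v w"
    using assms unfolding power_branch_def by metis
  have D: "(l has_field_derivative deriv l z) (at z)"
    using holomorphic_derivI[OF l] U by blast
  have "((\<lambda>w. exp (l w)) has_field_derivative exp (l z) * deriv l z) (at z)"
    by (rule derivative_eq_intros D refl | simp)+
  then have "(u has_field_derivative exp (l z) * deriv l z) (at z)"
    by (rule has_field_derivative_transform_within_open[OF _ U]) (rule ul)
  moreover have "((\<lambda>w. exp (of_real \<alpha> * l w)) has_field_derivative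
      exp (of_real \<alpha> * l z) * (of_real \<alpha> * deriv l z)) (at z)"
    by (rule derivative_eq_intros D refl | simp)+
  then have "(v has_field_derivative exp (of_real \<alpha> * l z) * (of_real \<alpha> * deriv l z)) (at z)"
    by (rule has_field_derivative_transform_within_open[OF _ U]) (rule vl)
  ultimately have "deriv u z = u z * deriv l z" "deriv v z = v z * (of_real \<alpha> * deriv l z)"
    using ul[OF U(2)] vl[OF U(2)] by (simp_all add: DERIV_imp_deriv)
  then show ?thesis
    by simp
qed

text \<open>
  The chain rule converts the relation for the logarithmic derivative of \<open>v = g \<circ> \<phi>\<close> into
  \<open>(\<zeta> - w) g' = \<alpha> g\<close> at \<open>\<zeta> = \<phi> z\<close>, since \<open>\<phi>'\<close> has no zeros and cancels. The identity theorem
  carries the equation from the open set \<open>\<phi> ` \<Omega>\<close> to \<open>\<Omega>\<close>, where the previous results force \<open>g = 0\<close>,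
  although \<open>v\<close> is zero-free.
\<close>

lemma power_branch_not_factor_through:
  assumes \<Omega>: "open \<Omega>" "connected \<Omega>"
    and \<phi>: "\<phi> holomorphic_on \<Omega>" "inj_on \<phi> \<Omega>" "\<phi> ` \<Omega> \<subseteq> \<Omega>"
    and w: "w \<in> \<Omega>"
    and v: "power_branch \<Omega> (\<lambda>z. \<phi> z - w) \<alpha> v" "\<alpha> \<notin> \<int>"
    and g: "g holomorphic_on \<Omega>" "\<And>z. z \<in> \<Omega> \<Longrightarrow> g (\<phi> z) = v z"
  shows False
proof -
  have D\<phi>: "(\<phi> has_field_derivative deriv \<phi> z) (at z)" if "z \<in> \<Omega>" for z
    using holomorphic_derivI \<phi> \<Omega> that by blast
  have ode: "(\<phi> z - w) * deriv g (\<phi> z) = of_real \<alpha> * g (\<phi> z)" if z: "z \<in> \<Omega>" for z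
  proof -
    have "(g has_field_derivative deriv g (\<phi> z)) (at (\<phi> z))"
      using holomorphic_derivI g(1) \<Omega>(1) \<phi>(3) z by blast
    then have "((\<lambda>z. g (\<phi> z)) has_field_derivative deriv g (\<phi> z) * deriv \<phi> z) (at z)"
      by (rule DERIV_chain2[OF _ D\<phi>[OF z]])
    then have "(v has_field_derivative deriv g (\<phi> z) * deriv \<phi> z) (at z)"
      by (rule has_field_derivative_transform_within_open[OF _ \<Omega>(1) z]) (rule g(2))
    then have "deriv v z = deriv g (\<phi> z) * deriv \<phi> z"
      by (rule DERIV_imp_deriv)
    moreover have "deriv (\<lambda>z. \<phi> z - w) z = deriv \<phi> z"
      using D\<phi>[OF z] by (intro DERIV_imp_deriv) (auto intro!: derivative_eq_intros)
    moreover have "deriv \<phi> z \<noteq> 0"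
      using holomorphic_injective_imp_regular[OF \<phi>(1) \<Omega>(1) \<phi>(2) z] .
    ultimately show ?thesis
      using power_branch_deriv[OF v(1) z] g(2)[OF z] by (simp add: mult.assoc)
  qed
  have open_image: "open (\<phi> ` \<Omega>)"
    using open_mapping_thm3[OF \<phi>(1) \<Omega>(1) \<phi>(2)] .
  have "(z - w) * deriv g z = of_real \<alpha> * g z" if "z \<in> \<Omega>" for z
  proof (rule analytic_continuation_open[OF open_image \<Omega>(1) _ \<Omega>(2) \<phi>(3) _ _ _ that])
    show "\<phi> ` \<Omega> \<noteq> {}"
      using w by blast
    show "(\<lambda>z. (z - w) * deriv g z) holomorphic_on \<Omega>"
      using g(1) \<Omega>(1) by (intro holomorphic_intros)
    show "(\<lambda>z. of_real \<alpha> * g z) holomorphic_on \<Omega>"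
      using g(1) by (intro holomorphic_intros)
  qed (use ode in auto)
  moreover have "complex_of_real \<alpha> \<notin> \<nat>"
    using v(2) Nats_subset_Ints of_real_in_Ints_iff[where 'a = complex] by blast
  ultimately have "g (\<phi> w) = 0"
    using euler_ode_eq_0[OF \<Omega> g(1) w] \<phi>(3) w by blast
  then show False
    using g(2)[OF w] power_branch_nonzero[OF v(1) w] by simp
qed

section \<open>Weighted composition operators that are onto\<close>

lemma weighted_comp_apply [simp]:
  "z \<in> \<Omega> \<Longrightarrow> weighted_comp \<Omega> F \<phi> f z = F z * f (\<phi> z)"
  by (simp add: weighted_comp_def)

lemma automorphism_inverse:
  assumes "open \<Omega>" "automorphism \<Omega> \<phi>"
  shows "automorphism \<Omega> (inv_into \<Omega> \<phi>)"
proof -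
  have \<phi>: "\<phi> holomorphic_on \<Omega>" "inj_on \<phi> \<Omega>" "\<phi> ` \<Omega> = \<Omega>"
    using assms(2) by (auto simp: automorphism_def bij_betw_def)
  obtain h where h: "h holomorphic_on \<phi> ` \<Omega>" "\<And>z. z \<in> \<Omega> \<Longrightarrow> h (\<phi> z) = z"
    using holomorphic_has_inverse[OF \<phi>(1) assms(1) \<phi>(2)] by metis
  have "h w = inv_into \<Omega> \<phi> w" if "w \<in> \<Omega>" for w
    using h(2)[of "inv_into \<Omega> \<phi> w"] that \<phi>(3) by (metis f_inv_into_f inv_into_into)
  then have "inv_into \<Omega> \<phi> holomorphic_on \<Omega>"
    using h(1) \<phi>(3) holomorphic_transform by metis
  moreover have "bij_betw (inv_into \<Omega> \<phi>) \<Omega> \<Omega>"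
    using assms(2) bij_betw_inv_into by (auto simp: automorphism_def)
  ultimately show ?thesis
    by (simp add: automorphism_def)
qed

lemma weighted_comp_inverse:
  assumes "automorphism \<Omega> \<phi>" "\<And>z. z \<in> \<Omega> \<Longrightarrow> F z \<noteq> 0" "\<And>z. z \<notin> \<Omega> \<Longrightarrow> f z = 0"
  defines "S \<equiv> weighted_comp \<Omega> (\<lambda>z. 1 / F (inv_into \<Omega> \<phi> z)) (inv_into \<Omega> \<phi>)"
  shows "S (weighted_comp \<Omega> F \<phi> f) = f" "weighted_comp \<Omega> F \<phi> (S f) = f"
proof -
  have \<phi>: "\<phi> z \<in> \<Omega>" "inv_into \<Omega> \<phi> z \<in> \<Omega>" "\<phi> (inv_into \<Omega> \<phi> z) = z"
    "inv_into \<Omega> \<phi> (\<phi> z) = z" if "z \<in> \<Omega>" for z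
    using assms(1) that by (auto simp: automorphism_def bij_betw_def inv_into_into f_inv_into_f)
  show "S (weighted_comp \<Omega> F \<phi> f) = f"
    using assms(2,3) \<phi> by (auto simp: S_def weighted_comp_def fun_eq_iff)
  show "weighted_comp \<Omega> F \<phi> (S f) = f"
    using assms(2,3) \<phi> by (auto simp: S_def weighted_comp_def fun_eq_iff)
qed

context analytic_banach_space
begin

lemma open_\<Omega>: "open \<Omega>" and connected_\<Omega>: "connected \<Omega>"
  using domain by (auto simp: is_domain_def)

lemma mem_outside: "f \<in> X \<Longrightarrow> z \<notin> \<Omega> \<Longrightarrow> f z = 0"
  using analytic by (auto simp: analytic_functions_def)

lemma mem_holomorphic: "f \<in> X \<Longrightarrow> f holomorphic_on \<Omega>"
  using analytic by (auto simp: analytic_functions_def)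

lemma shifted_power_mem:
  assumes "axiom_A2 \<Omega> X" "axiom_A3 X"
  shows "(\<lambda>z. if z \<in> \<Omega> then (z - w) ^ n else 0) \<in> X"
proof (induction n)
  case 0
  show ?case
    using assms(1) by (simp add: axiom_A2_def cong: if_cong)
next
  case (Suc n)
  let ?p = "\<lambda>z. if z \<in> \<Omega> then (z - w) ^ n else 0"
  have "(\<lambda>z. z * ?p z - w * ?p z) \<in> X"
    using assms(2) Suc diff_mem scale_mem by (auto simp: axiom_A3_def)
  also have "(\<lambda>z. z * ?p z - w * ?p z) = (\<lambda>z. if z \<in> \<Omega> then (z - w) ^ Suc n else 0)"
    by (auto simp: algebra_simps)
  finally show ?case .
qed

text \<open>
  The preimages \<open>f\<close> of \<open>1\<close> and \<open>g\<close> of \<open>\<chi>\<close> decide this: \<open>f \<circ> \<phi>\<close> is \<open>1 / F\<close>, and \<open>z\<close> can be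
  recovered from \<open>\<phi> z\<close> as the quotient of \<open>g (\<phi> z)\<close> by \<open>f (\<phi> z)\<close>.
\<close>

lemma onto_imp_nonzero_inj:
  assumes A: "axiom_A2 \<Omega> X" "axiom_A3 X"
    and onto: "weighted_comp \<Omega> F \<phi> ` X = X"
  shows "\<forall>z\<in>\<Omega>. F z \<noteq> 0" "inj_on \<phi> \<Omega>"
proof -
  \<comment> \<open>The functions \<open>1\<close> and \<open>\<chi>\<close> appear as the powers of \<open>z - 0\<close> with exponents \<open>0\<close> and \<open>1\<close>.\<close>
  obtain f where f: "(\<lambda>z. if z \<in> \<Omega> then (z - 0) ^ 0 else 0) = weighted_comp \<Omega> F \<phi> f"
    using equalityD2[OF onto, THEN subsetD, OF shifted_power_mem[OF A, of 0 0]] by (rule imageE)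
  obtain g where g: "(\<lambda>z. if z \<in> \<Omega> then (z - 0) ^ 1 else 0) = weighted_comp \<Omega> F \<phi> g"
    using equalityD2[OF onto, THEN subsetD, OF shifted_power_mem[OF A, of 0 1]] by (rule imageE)
  have f1: "F z * f (\<phi> z) = 1" if "z \<in> \<Omega>" for z
    using fun_cong[OF f, of z] that by simp
  have g1: "F z * g (\<phi> z) = z" if "z \<in> \<Omega>" for z
    using fun_cong[OF g, of z] that by simp
  show "\<forall>z\<in>\<Omega>. F z \<noteq> 0"
  proof
    fix z assume "z \<in> \<Omega>"
    then show "F z \<noteq> 0"
      using f1[of z] by auto
  qed
  show "inj_on \<phi> \<Omega>"
  proof (rule inj_onI)
    fix x y assume xy: "x \<in> \<Omega>" "y \<in> \<Omega>" "\<phi> x = \<phi> y"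
    have "F x * f (\<phi> y) = F y * f (\<phi> y)" "f (\<phi> y) \<noteq> 0"
      using f1[OF xy(1)] f1[OF xy(2)] xy(3) by auto
    then have "F x = F y"
      by simp
    then have "F x * g (\<phi> x) = F y * g (\<phi> y)"
      using xy(3) by simp
    then show "x = y"
      unfolding g1[OF xy(1)] g1[OF xy(2)] .
  qed
qed

text \<open>
  If \<open>\<phi>\<close> omitted \<open>w\<close>, then \<open>u = \<phi> - w\<close> would be admissible in the fractional power axiom with
  \<open>f = F = W 1\<close>, because the products \<open>F u ^ n\<close> are images of polynomials. A preimage under \<open>W\<close> of
  \<open>F u ^ \<alpha>\<close> would then be holomorphic at the branch point \<open>w\<close>.
\<close>

lemma onto_imp_automorphism:
  assumes "bounded \<Omega>"
    and A: "axiom_A2 \<Omega> X" "axiom_A3 X" "axiom_A4 \<Omega> X"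
    and \<phi>: "\<phi> holomorphic_on \<Omega>" "\<phi> ` \<Omega> \<subseteq> \<Omega>"
    and onto: "weighted_comp \<Omega> F \<phi> ` X = X"
  shows "automorphism \<Omega> \<phi>"
proof -
  let ?W = "weighted_comp \<Omega> F \<phi>"
  have F: "\<forall>z\<in>\<Omega>. F z \<noteq> 0" and inj: "inj_on \<phi> \<Omega>"
    using onto_imp_nonzero_inj[OF A(1,2) onto] .
  have "\<Omega> \<subseteq> \<phi> ` \<Omega>"
  proof (rule ccontr)
    assume "\<not> \<Omega> \<subseteq> \<phi> ` \<Omega>"
    then obtain w where w: "w \<in> \<Omega>" "w \<notin> \<phi> ` \<Omega>"
      by blast
    define u where "u = (\<lambda>z. \<phi> z - w)"
    let ?F = "\<lambda>z. if z \<in> \<Omega> then F z else 0"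
    have "u holomorphic_on \<Omega>"
      unfolding u_def using \<phi>(1) by (intro holomorphic_intros)
    moreover have "bounded (u ` \<Omega>)"
      using bounded_translation_minus[OF bounded_subset[OF \<open>bounded \<Omega>\<close> \<phi>(2)], of w]
      by (simp add: u_def image_image)
    moreover have "\<forall>z\<in>\<Omega>. u z \<noteq> 0"
      using w by (auto simp: u_def)
    ultimately have u: "u holomorphic_on \<Omega> \<and> bounded (u ` \<Omega>) \<and> (\<forall>z\<in>\<Omega>. u z \<noteq> 0)"
      by blast
    have Fu: "(\<lambda>z. ?F z * u z ^ n) \<in> X" for n
    proof -
      have eq: "?W (\<lambda>z. if z \<in> \<Omega> then (z - w) ^ n else 0) = (\<lambda>z. ?F z * u z ^ n)"
        using \<phi>(2) by (auto simp: weighted_comp_def u_def fun_eq_iff)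
      show ?thesis
        using imageI[OF shifted_power_mem[OF A(1,2)], of ?W w n] unfolding eq onto .
    qed
    have "?F \<in> X"
      using Fu[of 0] by simp
    then have "\<exists>\<alpha>>0. \<alpha> \<notin> \<int> \<and> (\<exists>v. power_branch \<Omega> u \<alpha> v \<and> (\<lambda>z. ?F z * v z) \<in> X)"
      using A(3)[unfolded axiom_A4_def, rule_format, of u ?F] u Fu by blast
    then obtain \<alpha> v where \<alpha>: "\<alpha> \<notin> \<int>" and v: "power_branch \<Omega> u \<alpha> v"
      and Fv: "(\<lambda>z. ?F z * v z) \<in> X"
      by blast
    obtain g where g: "(\<lambda>z. ?F z * v z) = ?W g" "g \<in> X"
      using equalityD2[OF onto, THEN subsetD, OF Fv] by (rule imageE)
    have "g (\<phi> z) = v z" if "z \<in> \<Omega>" for z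
      using fun_cong[OF g(1), of z] that F by simp
    then show False
      using power_branch_not_factor_through[OF open_\<Omega> connected_\<Omega> \<phi>(1) inj \<phi>(2) w(1)
          v[unfolded u_def] \<alpha> mem_holomorphic[OF g(2)]] by blast
  qed
  then show ?thesis
    using \<phi> inj by (auto simp: automorphism_def bij_betw_def)
qed

lemma automorphism_onto_imp_bounded_inverse:
  assumes W: "bounded_operator X N (weighted_comp \<Omega> F \<phi>)"
    and \<phi>: "automorphism \<Omega> \<phi>" and F: "\<forall>z\<in>\<Omega>. F z \<noteq> 0"
    and onto: "weighted_comp \<Omega> F \<phi> ` X = X"
  shows "bounded_inverse X N (weighted_comp \<Omega> F \<phi>)
    (weighted_comp \<Omega> (\<lambda>z. 1 / F (inv_into \<Omega> \<phi> z)) (inv_into \<Omega> \<phi>))"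
proof (rule bounded_inverse_theorem[OF W])
  let ?S = "weighted_comp \<Omega> (\<lambda>z. 1 / F (inv_into \<Omega> \<phi> z)) (inv_into \<Omega> \<phi>)"
  fix f assume f: "f \<in> X"
  have inverse: "?S (weighted_comp \<Omega> F \<phi> h) = h" "weighted_comp \<Omega> F \<phi> (?S h) = h"
    if "h \<in> X" for h
    by (rule weighted_comp_inverse[OF \<phi>]; use F mem_outside[OF that] in blast)+
  from f show "?S (weighted_comp \<Omega> F \<phi> f) = f" "weighted_comp \<Omega> F \<phi> (?S f) = f"
    by (rule inverse)+
  obtain h where "h \<in> X" "f = weighted_comp \<Omega> F \<phi> h"
    using onto f by blast
  then show "?S f \<in> X"
    using inverse(1) by simp
qed

lemma invertible_imp_onto:
  assumes "bounded_operator X N T" "invertible_on X N T"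
  shows "T ` X = X"
proof -
  obtain S where S: "bounded_inverse X N T S"
    using assms(2) by (auto simp: invertible_on_def)
  show ?thesis
  proof
    show "T ` X \<subseteq> X"
      using assms(1) by (auto simp: bounded_operator_def)
    show "X \<subseteq> T ` X"
    proof
      fix f assume f: "f \<in> X"
      then have "S f \<in> X" "T (S f) = f"
        using S unfolding bounded_inverse_def bounded_operator_def by blast+
      then show "f \<in> T ` X"
        by (metis imageI)
    qed
  qed
qed

end

section \<open>Weights as multipliers\<close>

context analytic_banach_space
begin

lemma comp_automorphism_mem:
  assumes "axiom_A5 \<Omega> X N" "automorphism \<Omega> \<eta>" "f \<in> X"
  shows "(\<lambda>z. if z \<in> \<Omega> then f (\<eta> z) else 0) \<in> X"
  using assms by (auto simp: axiom_A5_def bounded_operator_def comp_operator_def)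

text \<open>
  Dividing \<open>f = W h\<close> by \<open>F\<close> leaves \<open>h \<circ> \<phi>\<close>.
\<close>

lemma onto_imp_inverse_weight_multiplier:
  assumes A5: "axiom_A5 \<Omega> X N"
    and \<phi>: "automorphism \<Omega> \<phi>" and F: "\<forall>z\<in>\<Omega>. F z \<noteq> 0"
    and onto: "weighted_comp \<Omega> F \<phi> ` X = X"
  shows "(\<lambda>z. 1 / F z) \<in> multipliers X"
  unfolding multipliers_def
proof clarify
  fix f assume "f \<in> X"
  then obtain h where h: "h \<in> X" "f = weighted_comp \<Omega> F \<phi> h"
    using onto by blast
  have "(\<lambda>z. 1 / F z * f z) = (\<lambda>z. if z \<in> \<Omega> then h (\<phi> z) else 0)"
    using F by (auto simp: h weighted_comp_def fun_eq_iff)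
  then show "(\<lambda>z. 1 / F z * f z) \<in> X"
    using comp_automorphism_mem[OF A5 \<phi> h(1)] by simp
qed

text \<open>
  Multiplication by \<open>F\<close> is \<open>W\<close> preceded by composition with \<open>\<phi>\<^sup>-\<^sup>1\<close>.
\<close>

lemma weight_multiplier:
  assumes A5: "axiom_A5 \<Omega> X N" and \<phi>: "automorphism \<Omega> \<phi>"
    and W: "weighted_comp \<Omega> F \<phi> ` X \<subseteq> X"
  shows "F \<in> multipliers X"
  unfolding multipliers_def
proof clarify
  fix f assume f: "f \<in> X"
  have "\<phi> z \<in> \<Omega>" "inv_into \<Omega> \<phi> (\<phi> z) = z" if "z \<in> \<Omega>" for z
    using \<phi> that by (auto simp: automorphism_def bij_betw_def)
  then have "(\<lambda>z. F z * f z)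
      = weighted_comp \<Omega> F \<phi> (\<lambda>z. if z \<in> \<Omega> then f (inv_into \<Omega> \<phi> z) else 0)"
    using mem_outside[OF f] by (auto simp: weighted_comp_def fun_eq_iff)
  then show "(\<lambda>z. F z * f z) \<in> X"
    using W comp_automorphism_mem[OF A5 automorphism_inverse[OF open_\<Omega> \<phi>] f] by auto
qed

text \<open>
  The preimage of \<open>f\<close> is \<open>(f / F) \<circ> \<phi>\<^sup>-\<^sup>1\<close>.
\<close>

lemma inverse_weight_multiplier_imp_onto:
  assumes A5: "axiom_A5 \<Omega> X N" and \<phi>: "automorphism \<Omega> \<phi>"
    and F: "\<forall>z\<in>\<Omega>. F z \<noteq> 0" "(\<lambda>z. 1 / F z) \<in> multipliers X"
    and W: "weighted_comp \<Omega> F \<phi> ` X \<subseteq> X"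
  shows "weighted_comp \<Omega> F \<phi> ` X = X"
proof
  show "X \<subseteq> weighted_comp \<Omega> F \<phi> ` X"
  proof
    fix f assume f: "f \<in> X"
    define h where "h = (\<lambda>z. if z \<in> \<Omega> then 1 / F (inv_into \<Omega> \<phi> z) * f (inv_into \<Omega> \<phi> z) else 0)"
    have "(\<lambda>z. 1 / F z * f z) \<in> X"
      using F(2) f by (auto simp: multipliers_def)
    then have "h \<in> X"
      unfolding h_def by (rule comp_automorphism_mem[OF A5 automorphism_inverse[OF open_\<Omega> \<phi>]])
    moreover have "\<phi> z \<in> \<Omega>" "inv_into \<Omega> \<phi> (\<phi> z) = z" if "z \<in> \<Omega>" for z
      using \<phi> that by (auto simp: automorphism_def bij_betw_def)
    then have "f = weighted_comp \<Omega> F \<phi> h"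
      using mem_outside[OF f] F(1) by (auto simp: weighted_comp_def h_def fun_eq_iff)
    ultimately show "f \<in> weighted_comp \<Omega> F \<phi> ` X"
      by blast
  qed
qed (rule W)

end

section \<open>Characterization of invertibility\<close>

theorem theorem1:
  fixes \<Omega> :: "complex set"
    and X :: "(complex \<Rightarrow> complex) set"
    and N :: "(complex \<Rightarrow> complex) \<Rightarrow> real"
    and F \<phi> :: "complex \<Rightarrow> complex"
  defines "W \<equiv> weighted_comp \<Omega> F \<phi>"
    and "\<psi> \<equiv> inv_into \<Omega> \<phi>"
    and "G \<equiv> (\<lambda>z. 1 / F (inv_into \<Omega> \<phi> z))"
  assumes "bounded \<Omega>"
    and "analytic_banach_space \<Omega> X N"
    and "axiom_A1 \<Omega> X N" and "axiom_A2 \<Omega> X" and "axiom_A3 X" and "axiom_A4 \<Omega> X"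
    and "F holomorphic_on \<Omega>"
    and "\<phi> holomorphic_on \<Omega>" and "\<phi> ` \<Omega> \<subseteq> \<Omega>"
    and "bounded_operator X N W"
  shows "((invertible_on X N W \<longleftrightarrow> W ` X = X) \<and>
          (invertible_on X N W \<longrightarrow>
            automorphism \<Omega> \<phi> \<and> (\<forall>z\<in>\<Omega>. F z \<noteq> 0) \<and>
            G holomorphic_on \<Omega> \<and> \<psi> holomorphic_on \<Omega> \<and> \<psi> ` \<Omega> \<subseteq> \<Omega> \<and>
            bounded_inverse X N W (weighted_comp \<Omega> G \<psi>))) \<and>
         (axiom_A5 \<Omega> X N \<longrightarrow>
          (invertible_on X N W \<longleftrightarrow>
            automorphism \<Omega> \<phi> \<and> (\<forall>z\<in>\<Omega>. F z \<noteq> 0) \<and> (\<lambda>z. 1 / F z) \<in> multipliers X) \<and>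
          (invertible_on X N W \<longrightarrow>
            F \<in> multipliers X \<and>
            G holomorphic_on \<Omega> \<and> \<psi> holomorphic_on \<Omega> \<and> \<psi> ` \<Omega> \<subseteq> \<Omega> \<and>
            bounded_inverse X N W (weighted_comp \<Omega> G \<psi>)))"
proof -
  interpret analytic_banach_space \<Omega> X N
    by fact
  have W: "bounded_operator X N (weighted_comp \<Omega> F \<phi>)"
    using assms(13) by (simp only: W_def)
  then have W_mem: "weighted_comp \<Omega> F \<phi> ` X \<subseteq> X"
    by (auto simp: bounded_operator_def)
  have onto_imp: "automorphism \<Omega> \<phi> \<and> (\<forall>z\<in>\<Omega>. F z \<noteq> 0) \<and>
      G holomorphic_on \<Omega> \<and> \<psi> holomorphic_on \<Omega> \<and> \<psi> ` \<Omega> \<subseteq> \<Omega> \<and>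
      bounded_inverse X N W (weighted_comp \<Omega> G \<psi>)" if "W ` X = X"
  proof -
    have onto: "weighted_comp \<Omega> F \<phi> ` X = X"
      using that by (simp only: W_def)
    have \<phi>: "automorphism \<Omega> \<phi>"
      by (rule onto_imp_automorphism[OF assms(4,7-9,11,12) onto])
    have F: "\<forall>z\<in>\<Omega>. F z \<noteq> 0"
      by (rule onto_imp_nonzero_inj(1)[OF assms(7,8) onto])
    have "automorphism \<Omega> \<psi>"
      unfolding \<psi>_def by (rule automorphism_inverse[OF open_\<Omega> \<phi>])
    then have \<psi>: "\<psi> holomorphic_on \<Omega>" "\<psi> ` \<Omega> = \<Omega>"
      by (auto simp: automorphism_def bij_betw_def)
    have "(\<lambda>z. F (\<psi> z)) holomorphic_on \<Omega>"
      using holomorphic_on_compose_gen[OF \<psi>(1) assms(10)] \<psi>(2) by (simp add: o_def)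
    moreover have "F (\<psi> z) \<noteq> 0" if "z \<in> \<Omega>" for z
      using F \<psi>(2) that by auto
    ultimately have "(\<lambda>z. 1 / F (\<psi> z)) holomorphic_on \<Omega>"
      by (intro holomorphic_intros)
    then have "G holomorphic_on \<Omega>"
      by (simp add: G_def \<psi>_def)
    moreover have "bounded_inverse X N W (weighted_comp \<Omega> G \<psi>)"
      unfolding W_def G_def \<psi>_def
      by (rule automorphism_onto_imp_bounded_inverse[OF W \<phi> F onto])
    ultimately show ?thesis
      using \<phi> F \<psi> by blast
  qed
  have invertible_iff: "invertible_on X N W \<longleftrightarrow> W ` X = X"
    using invertible_imp_onto[OF assms(13)] onto_imp unfolding invertible_on_def by blast
  have onto_imp_multipliers: "(\<lambda>z. 1 / F z) \<in> multipliers X \<and> F \<in> multipliers X"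
    if A5: "axiom_A5 \<Omega> X N" and onto: "W ` X = X"
    using onto_imp_inverse_weight_multiplier[OF A5 _ _ onto[unfolded W_def]]
      weight_multiplier[OF A5 _ W_mem] onto_imp[OF onto] by blast
  have multiplier_imp_onto: "W ` X = X"
    if "axiom_A5 \<Omega> X N" "automorphism \<Omega> \<phi>" "\<forall>z\<in>\<Omega>. F z \<noteq> 0" "(\<lambda>z. 1 / F z) \<in> multipliers X"
    unfolding W_def by (rule inverse_weight_multiplier_imp_onto[OF that W_mem])
  show ?thesis
    unfolding invertible_iff using onto_imp onto_imp_multipliers multiplier_imp_onto by blast
qed

end
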